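(* For any prime $p\ge 13$ with $p\equiv 1\pmod 4$, the cyclic group $\mathbb{Z}_p$ has at least one non $\mathcal{P}$-interval metric, i.e. there is an invariant metric on $\mathbb{Z}_p$ which is not $\mathcal{P}$-interval.
   Context: All metrics on groups are integral (integer valued) and right translation invariant: $d(gh,g'h)=d(g,g')$ for all $g,g',h\in G$. The weight of $d$ is $w(x)=d(x,e)$, $e$ the identity of $G$. The partition induced by $d$, denoted $P(G,d)$, is the set of classes of the equivalence relation $g\sim h\Leftrightarrow w(g)=w(h)$. An interval metric is such a metric $d$ with finitely many weights and without gaps: if $P(G,d)$ has $n$ parts different from $\{e\}$, then the set of values of $w$ is exactly $\{0,1,\ldots,n\}$. A metric $d$ on $G$ is $\mathcal{P}$-interval if there is an interval metric $d'$ on $G$ with $P(G,d)=P(G,d')$. *)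

theory Defs
  imports
    "HOL-Algebra.Elementary_Groups"
    "HOL-Analysis.Abstract_Metric_Spaces"
    "HOL-Number_Theory.Cong"
begin

text \<open>
  The library locale \<open>Metric_space\<close> asks for nonnegativity and symmetry on the whole type, not just
  on the carrier. Nothing is lost: a metric given on the carrier extends by 0 to all other pairs,
  and every notion below depends on the values on the carrier only.
\<close>

locale integral_invariant_metric = group G + Metric_space "carrier G" d
  for G :: "('a, 'b) monoid_scheme" (structure) and d :: "'a \<Rightarrow> 'a \<Rightarrow> real" +
  assumes integral: "\<lbrakk>g \<in> carrier G; h \<in> carrier G\<rbrakk> \<Longrightarrow> d g h \<in> \<int>"
    and right_invariant:
      "\<lbrakk>g \<in> carrier G; g' \<in> carrier G; h \<in> carrier G\<rbrakk> \<Longrightarrow> d (g \<otimes> h) (g' \<otimes> h) = d g g'"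

definition weight :: "('a, 'b) monoid_scheme \<Rightarrow> ('a \<Rightarrow> 'a \<Rightarrow> real) \<Rightarrow> 'a \<Rightarrow> real"
  where "weight G d x = d x \<one>\<^bsub>G\<^esub>"

definition metric_partition :: "('a, 'b) monoid_scheme \<Rightarrow> ('a \<Rightarrow> 'a \<Rightarrow> real) \<Rightarrow> 'a set set"
  where "metric_partition G d =
    carrier G // {(g, h). g \<in> carrier G \<and> h \<in> carrier G \<and> weight G d g = weight G d h}"

definition interval_metric :: "('a, 'b) monoid_scheme \<Rightarrow> ('a \<Rightarrow> 'a \<Rightarrow> real) \<Rightarrow> bool"
  where "interval_metric G d \<longleftrightarrow>
    integral_invariant_metric G d \<and>
    finite (weight G d ` carrier G) \<and>
    weight G d ` carrier G = real ` {0..card (metric_partition G d - {{\<one>\<^bsub>G\<^esub>}})}"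

definition P_interval :: "('a, 'b) monoid_scheme \<Rightarrow> ('a \<Rightarrow> 'a \<Rightarrow> real) \<Rightarrow> bool"
  where "P_interval G d \<longleftrightarrow>
    integral_invariant_metric G d \<and>
    (\<exists>d'. interval_metric G d' \<and> metric_partition G d = metric_partition G d')"

end

theory Submission
  imports Defs
begin

text \<open>
  Split the nonzero residues, up to sign, into \<open>B = {2, 3}\<close>, \<open>C = {4, 6}\<close> and the class \<open>A\<close> of
  all others. Giving these classes weights between 2 and 4 always defines a metric. In an interval
  metric with the same partition the classes would have weights 1, 2, 3 in some order, so the class
  \<open>X\<close> of weight 1 and the class \<open>Y\<close> of weight 3 satisfy \<open>(X + X) \<inter> Y = {}\<close>. But the
  sums \<open>1 + 1 = 2\<close>, \<open>1 + 5 = 6\<close>, \<open>2 + 2 = 4\<close>, \<open>2 + 3 = 5\<close>, \<open>6 - 4 = 2\<close> and \<open>4 + 4 = 8\<close> show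
  that \<open>X + X\<close> meets \<open>Y\<close> for every choice of two classes. Here \<open>8\<close> lies in \<open>A\<close> also for \<open>p = 13\<close>,
  where it equals \<open>- 5\<close>.
\<close>

lemma weight_eq_iff_metric_partition:
  assumes "g \<in> carrier G" "h \<in> carrier G"
  shows "weight G d g = weight G d h \<longleftrightarrow> (\<exists>X \<in> metric_partition G d. g \<in> X \<and> h \<in> X)"
  using assms unfolding metric_partition_def quotient_def by auto

text \<open>Transfers the explicit classes of a constructed metric to any metric with the same
  partition.\<close>

lemma weight_eq_iff_of_metric_partition_eq:
  assumes "metric_partition G d = metric_partition G d'" "g \<in> carrier G" "h \<in> carrier G"
  shows "weight G d g = weight G d h \<longleftrightarrow> weight G d' g = weight G d' h"
  using assms by (simp add: weight_eq_iff_metric_partition)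

text \<open>The triangle inequality is applied through the point \<open>h\<close>; right invariance
  then cancels \<open>h\<close> in the first term.\<close>

lemma (in integral_invariant_metric) weight_mult_le:
  assumes "g \<in> carrier G" "h \<in> carrier G"
  shows "weight G d (g \<otimes> h) \<le> weight G d g + weight G d h"
proof -
  have "d (g \<otimes> h) \<one> \<le> d (g \<otimes> h) (\<one> \<otimes> h) + d h \<one>"
    using assms triangle[of "g \<otimes> h" h \<one>] by simp
  then show ?thesis
    using assms right_invariant[of g \<one> h] by (simp add: weight_def)
qed

text \<open>A length on all integers that is periodic modulo \<open>p\<close> allows
  \<open>g - h\<close> to be formed in the integers, without reduction into the carrier.\<close>

lemma integral_invariant_metric_integer_mod_group:
  fixes p :: nat and w :: "int \<Rightarrow> real"
  assumes p: "p > 0"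
    and w_int: "\<And>x. w x \<in> \<int>" and w_nonneg: "\<And>x. 0 \<le> w x"
    and w_zero: "\<And>x. w x = 0 \<longleftrightarrow> int p dvd x"
    and w_mod: "\<And>x. w (x mod int p) = w x"
    and w_minus: "\<And>x. w (- x) = w x"
    and w_add: "\<And>x y. w (x + y) \<le> w x + w y"
  shows "integral_invariant_metric (integer_mod_group p) (\<lambda>g h. w (g - h))"
proof -
  have car: "carrier (integer_mod_group p) = {0..<int p}"
    using p by (simp add: carrier_integer_mod_group)
  have "Metric_space (carrier (integer_mod_group p)) (\<lambda>g h. w (g - h))"
  proof
    fix x y :: int
    show "w (x - y) = w (y - x)"
      using w_minus[of "x - y"] by simp
    assume "x \<in> carrier (integer_mod_group p)" "y \<in> carrier (integer_mod_group p)"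
    then show "w (x - y) = 0 \<longleftrightarrow> x = y"
      unfolding car w_zero by (metis atLeastLessThan_iff mod_eq_dvd_iff mod_pos_pos_trivial)
  next
    fix x y z :: int
    show "w (x - z) \<le> w (x - y) + w (y - z)"
      using w_add[of "x - y" "y - z"] by simp
  qed (rule w_nonneg)
  moreover have "w ((g + h) mod int p - (g' + h) mod int p) = w (g - g')" for g g' h
    \<comment> \<open>Both arguments of \<open>w\<close> are congruent modulo
      \<open>p\<close>.\<close>
    by (metis (no_types, opaque_lifting) w_mod add_diff_cancel_right mod_diff_eq)
  ultimately show ?thesis
    unfolding integral_invariant_metric_def integral_invariant_metric_axioms_def
    using w_int by (auto simp: mult_integer_mod_group)
qed

text \<open>Counting both sides gives \<open>n + 1 = 4\<close>, so the nonzero values are 1, 2,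
  3.\<close>

lemma four_weights_interval:
  fixes a b c :: real
  assumes "{0, a, b, c} = real ` {0..n}" "card {0, a, b, c} = 4"
  shows "1 \<in> {a, b, c}" "3 \<in> {a, b, c}"
proof -
  have "card (real ` {0..n}) = Suc n"
    by (simp add: card_image)
  then have "n = 3"
    using assms by simp
  then have "1 \<in> real ` {0..n}" "3 \<in> real ` {0..n}"
    by (auto intro: rev_image_eqI[of 1] rev_image_eqI[of 3])
  then show "1 \<in> {a, b, c}" "3 \<in> {a, b, c}"
    unfolding assms(1)[symmetric] by auto
qed

text \<open>For \<open>p > 0\<close> this is the distance from \<open>x\<close> to the nearest
  multiple of \<open>p\<close>, a canonical representative of the residue up to sign.\<close>

definition abs_residue :: "nat \<Rightarrow> int \<Rightarrow> int"
  where "abs_residue p x = min (x mod int p) (- x mod int p)"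

definition three_class_weight :: "nat \<Rightarrow> int \<Rightarrow> real"
  where "three_class_weight p x =
    (if int p dvd x then 0
     else if abs_residue p x \<in> {2, 3} then 3
     else if abs_residue p x \<in> {4, 6} then 4 else 2)"

lemma abs_residue_of_range:
  assumes "0 < x" "x < int p"
  shows "abs_residue p x = min x (int p - x)"
  using assms by (simp add: abs_residue_def zmod_zminus1_eq_if)

lemma three_class_weight_nonneg: "0 \<le> three_class_weight p x"
  by (simp add: three_class_weight_def)

lemma three_class_weight_add_dvd:
  assumes "int p dvd x"
  shows "three_class_weight p (x + y) = three_class_weight p y"
proof -
  have "(x + y) mod int p = y mod int p" "- (x + y) mod int p = - y mod int p"
    using assms by (simp_all add: mod_eq_dvd_iff)
  then show ?thesis
    unfolding three_class_weight_def abs_residue_def using assms by (simp add: dvd_add_right_iff)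
qed

text \<open>If neither \<open>x\<close> nor \<open>y\<close> is divisible by \<open>p\<close>, the
  triangle inequality is just 4 \<le> 2 + 2. Otherwise one summand is a multiple of \<open>p\<close>
  and changes nothing.\<close>

lemma integral_invariant_metric_three_class_weight:
  assumes "p > 0"
  shows "integral_invariant_metric (integer_mod_group p) (\<lambda>g h. three_class_weight p (g - h))"
proof (rule integral_invariant_metric_integer_mod_group[OF assms])
  fix x y :: int
  show "three_class_weight p (x mod int p) = three_class_weight p x"
    by (simp add: three_class_weight_def abs_residue_def mod_minus_eq dvd_mod_iff)
  show "three_class_weight p (- x) = three_class_weight p x"
    by (simp add: three_class_weight_def abs_residue_def min.commute)
  show "three_class_weight p (x + y) \<le> three_class_weight p x + three_class_weight p y"
  proof (cases "int p dvd x \<or> int p dvd y")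
    case True
    then show ?thesis
      using three_class_weight_add_dvd[of p x y] three_class_weight_add_dvd[of p y x]
      by (auto simp: add.commute three_class_weight_nonneg)
  qed (simp add: three_class_weight_def)
qed (auto simp: three_class_weight_def)

text \<open>The value 14 is excluded because there 8 = -6 would fall into the class \<open>C\<close>
  instead of \<open>A\<close>.\<close>

lemma not_P_interval_three_class_weight:
  fixes p :: nat
  assumes p: "p \<ge> 13" "p \<noteq> 14"
  defines "G \<equiv> integer_mod_group p"
  shows "\<not> P_interval G (\<lambda>g h. three_class_weight p (g - h))"
proof
  let ?d = "\<lambda>g h. three_class_weight p (g - h)"
  assume "P_interval G ?d"
  then obtain d' where d': "interval_metric G d'"
    and part: "metric_partition G ?d = metric_partition G d'"
    unfolding P_interval_def by blast
  interpret integral_invariant_metric G d'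
    using d' by (simp add: interval_metric_def)
  define w where "w = weight G d'"
  have car: "carrier G = {0..<int p}"
    using p by (simp add: G_def carrier_integer_mod_group)
  have one_eq: "\<one>\<^bsub>G\<^esub> = 0" and mult: "x \<otimes>\<^bsub>G\<^esub> y = (x + y) mod int p" for x y
    by (simp_all add: G_def mult_integer_mod_group)
  have w_iff: "w x = w y \<longleftrightarrow> three_class_weight p x = three_class_weight p y"
    if "0 \<le> x" "x < int p" "0 \<le> y" "y < int p" for x y
    using weight_eq_iff_of_metric_partition_eq[OF part, of x y] that
    by (simp add: car w_def weight_def[of G ?d] one_eq)
  have w_add: "w ((x + y) mod int p) \<le> w x + w y"
    if "0 \<le> x" "x < int p" "0 \<le> y" "y < int p" for x y
    using weight_mult_le[of x y] that by (simp add: car w_def mult)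
  have w0: "w 0 = 0"
    using zero[of 0 0] p by (simp add: w_def weight_def car one_eq)
  have val: "three_class_weight p x =
      (if min x (int p - x) \<in> {2, 3} then 3 else if min x (int p - x) \<in> {4, 6} then 4 else 2)"
    if "0 < x" "x < int p" for x
    using that zdvd_not_zless[OF that] by (simp add: three_class_weight_def abs_residue_of_range)
  have val0: "three_class_weight p 0 = 0"
    by (simp add: three_class_weight_def)
  \<comment> \<open>The elements 1, 2, 4 represent the classes \<open>A\<close>, \<open>B\<close>,
    \<open>C\<close>.\<close>
  have ne: "w 1 \<noteq> 0" "w 2 \<noteq> 0" "w 4 \<noteq> 0" "w 1 \<noteq> w 2" "w 1 \<noteq> w 4" "w 2 \<noteq> w 4"
    using w_iff[of 1 0] w_iff[of 2 0] w_iff[of 4 0] w_iff[of 1 2] w_iff[of 1 4] w_iff[of 2 4] p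
    by (simp_all add: w0 val val0 min_def)
  have eq: "w 3 = w 2" "w 5 = w 1" "w 6 = w 4" "w (int p - 4) = w 4" "w 8 = w 1"
    using w_iff[of 3 2] w_iff[of 5 1] w_iff[of 6 4] w_iff[of "int p - 4" 4] w_iff[of 8 1] p
    by (auto simp: val min_def)
  \<comment> \<open>One inequality for each ordered pair of classes: a sum of two elements of one
    class lies in the other. Here \<open>int p - 4\<close> stands for -4, so that adding 6 gives
    2.\<close>
  have le: "w 2 \<le> 2 * w 1" "w 4 \<le> 2 * w 1" "w 1 \<le> 2 * w 2" "w 4 \<le> 2 * w 2"
      "w 1 \<le> 2 * w 4" "w 2 \<le> 2 * w 4"
    using w_add[of 1 1] w_add[of 1 5] w_add[of 2 3] w_add[of 2 2] w_add[of 4 4]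
      w_add[of 6 "int p - 4"] p
    by (simp_all add: eq)
  have "w ` carrier G = {0, w 1, w 2, w 4}"
  proof
    show "w ` carrier G \<subseteq> {0, w 1, w 2, w 4}"
    proof
      fix v assume "v \<in> w ` carrier G"
      then obtain x where x: "v = w x" "0 \<le> x" "x < int p"
        by (auto simp: car)
      show "v \<in> {0, w 1, w 2, w 4}"
      proof (cases "x = 0")
        case False
        then show ?thesis
          using x p w_iff[of x 1] w_iff[of x 2] w_iff[of x 4] by (auto simp: val)
      qed (simp add: x w0)
    qed
    show "{0, w 1, w 2, w 4} \<subseteq> w ` carrier G"
      using p w0[symmetric] by (auto simp: car)
  qed
  moreover obtain n where "w ` carrier G = real ` {0..n}"
    using d' unfolding interval_metric_def w_def by blast
  ultimately have "{0, w 1, w 2, w 4} = real ` {0..n}"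
    by simp
  moreover have "card {0, w 1, w 2, w 4} = 4"
    using ne by auto
  ultimately have "1 \<in> {w 1, w 2, w 4}" "3 \<in> {w 1, w 2, w 4}"
    by (rule four_weights_interval)+
  \<comment> \<open>The classes of weight 1 and 3 are distinct, so one of the six inequalities would
    read 3 \<le> 2.\<close>
  then show False
    using le by auto
qed

theorem corollary2p5:
  fixes p :: nat
  assumes "prime p" and "p \<ge> 13" and "[p = 1] (mod 4)"
  shows "\<exists>d. integral_invariant_metric (integer_mod_group p) d \<and>
             \<not> P_interval (integer_mod_group p) d"
proof -
  \<comment> \<open>Modulo 4, the number 14 is 2.\<close>
  have "p \<noteq> 14"
    using assms(3) by (auto simp: cong_def)
  then show ?thesis
    using integral_invariant_metric_three_class_weight not_P_interval_three_class_weight assms(2)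
    by (metis less_le_trans zero_less_numeral)
qed

end
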